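(* Let $f:\mathbb{R}^n\to\mathbb{R}^n$ be a $C^3$ function with $f(x^* )=0$. If $f'(x^* )$ is nonsingular, then there exist a $\rho>0$ and a constant $C$ depending only on $f$ such that for $x_k$ and $x_{k-1}$ in $B_\rho(x^* )$ and $\eta_{k+1}<1$, $$\|x_{k+1}^{\mathrm{NA}}-x_{k+1}^{\mathrm{Newt}}\|\le C\left(\frac{\beta_{k+1}}{1-\beta_{k+1}}\right)\max\{\|e_k\|^2,\|e_{k-1}\|^2\}$$ when $\lambda_{k+1}=1$, and $$\|x_{k+1}^{\mathrm{NA}}-x_{k+1}^{\mathrm{Newt}}\|\le C\left(\frac{\beta_{k+1}}{1+\operatorname{sign}(\gamma_{k+1})\beta_{k+1}}\right)\max\{\|e_k\|^2,\|e_{k-1}\|^2\}$$ when $\lambda_{k+1}<1$.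
   Context: $\|\cdot\|$ is the Euclidean norm and $B_\rho(x)$ is the ball of radius $\rho$ centered at $x$. Fix a parameter $\hat r\in(0,1)$. Given $x_k,x_{k-1}$, set $e_j=x_j-x^*$, $w_{j+1}=-f'(x_j)^{-1}f(x_j)$ and $x_{j+1}^{\mathrm{Newt}}=x_j+w_{j+1}$ for $j=k-1,k$. The adaptive $\gamma$-safeguarded Newton-Anderson step is defined as follows: - $\gamma_{k+1}=(w_{k+1}-w_k)^Tw_{k+1}/\|w_{k+1}-w_k\|^2$; - $\eta_{k+1}=\|w_{k+1}\|/\|w_k\|$, $r_{k+1}=\min\{\eta_{k+1},\hat r\}$, $\beta_{k+1}=r_{k+1}\eta_{k+1}$; - if $\gamma_{k+1}=0$ or $\gamma_{k+1}\ge 1$, set $\lambda_{k+1}=0$; else if $|\gamma_{k+1}|/|1-\gamma_{k+1}|>\beta_{k+1}$, set $\lambda_{k+1}=\dfrac{\beta_{k+1}}{\gamma_{k+1}(\beta_{k+1}+\operatorname{sign}(\gamma_{k+1}))}$; otherwise set $\lambda_{k+1}=1$; - $x_{k+1}^{\mathrm{NA}}=x_{k+1}^{\mathrm{Newt}}-\lambda_{k+1}\gamma_{k+1}(x_{k+1}^{\mathrm{Newt}}-x_k^{\mathrm{Newt}})$. *)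

theory Defs
  imports "HOL-Analysis.Analysis"
begin

definition C3 :: "('a::real_normed_vector \<Rightarrow> 'b::real_normed_vector) \<Rightarrow> bool" where
  "C3 f \<longleftrightarrow>
    (\<exists>(f1 :: 'a \<Rightarrow> 'a \<Rightarrow>\<^sub>L 'b)
      (f2 :: 'a \<Rightarrow> 'a \<Rightarrow>\<^sub>L 'a \<Rightarrow>\<^sub>L 'b)
      (f3 :: 'a \<Rightarrow> 'a \<Rightarrow>\<^sub>L 'a \<Rightarrow>\<^sub>L 'a \<Rightarrow>\<^sub>L 'b).
       (\<forall>x. (f has_derivative blinfun_apply (f1 x)) (at x)) \<and>
       (\<forall>x. (f1 has_derivative blinfun_apply (f2 x)) (at x)) \<and>
       (\<forall>x. (f2 has_derivative blinfun_apply (f3 x)) (at x)) \<and>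
       continuous_on UNIV f3)"

(* matrix_inv is unspecified at points where the Jacobian is singular. *)
definition newton_update :: "(real^'n \<Rightarrow> real^'n) \<Rightarrow> real^'n \<Rightarrow> real^'n" where
  "newton_update f x = - (matrix_inv (jacobian f (at x)) *v f x)"

definition newton_iterate :: "(real^'n \<Rightarrow> real^'n) \<Rightarrow> real^'n \<Rightarrow> real^'n" where
  "newton_iterate f x = x + newton_update f x"

(* Below, x is the current iterate x_k and xp the previous one x_(k-1), so that
   newton_update f x is w_(k+1) and newton_update f xp is w_k; the values
   defined are those carrying the index k+1. *)

definition na_gamma :: "(real^'n \<Rightarrow> real^'n) \<Rightarrow> real^'n \<Rightarrow> real^'n \<Rightarrow> real" where
  "na_gamma f xp x =
     (newton_update f x - newton_update f xp) \<bullet> newton_update f x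
       / (norm (newton_update f x - newton_update f xp))\<^sup>2"

(* If newton_update f xp = 0, division by zero makes this 0. *)
definition na_eta :: "(real^'n \<Rightarrow> real^'n) \<Rightarrow> real^'n \<Rightarrow> real^'n \<Rightarrow> real" where
  "na_eta f xp x = norm (newton_update f x) / norm (newton_update f xp)"

definition na_r :: "real \<Rightarrow> (real^'n \<Rightarrow> real^'n) \<Rightarrow> real^'n \<Rightarrow> real^'n \<Rightarrow> real" where
  "na_r rhat f xp x = min (na_eta f xp x) rhat"

definition na_beta :: "real \<Rightarrow> (real^'n \<Rightarrow> real^'n) \<Rightarrow> real^'n \<Rightarrow> real^'n \<Rightarrow> real" where
  "na_beta rhat f xp x = na_r rhat f xp x * na_eta f xp x"

definition na_lambda :: "real \<Rightarrow> (real^'n \<Rightarrow> real^'n) \<Rightarrow> real^'n \<Rightarrow> real^'n \<Rightarrow> real" where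
  "na_lambda rhat f xp x =
     (let \<gamma> = na_gamma f xp x; \<beta> = na_beta rhat f xp x in
      if \<gamma> = 0 \<or> \<gamma> \<ge> 1 then 0
      else if \<bar>\<gamma>\<bar> / \<bar>1 - \<gamma>\<bar> > \<beta> then \<beta> / (\<gamma> * (\<beta> + sgn \<gamma>))
      else 1)"

definition na_iterate :: "real \<Rightarrow> (real^'n \<Rightarrow> real^'n) \<Rightarrow> real^'n \<Rightarrow> real^'n \<Rightarrow> real^'n" where
  "na_iterate rhat f xp x =
     newton_iterate f x
       - (na_lambda rhat f xp x * na_gamma f xp x)
           *\<^sub>R (newton_iterate f x - newton_iterate f xp)"

end

theory Submission
  imports Defs
begin

text \<open>
  Near a zero \<open>xstar\<close> with invertible Jacobian, Newton's method converges quadratically, so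
  both Newton iterates that enter an Anderson step lie within a constant times
  \<open>max (norm (x - xstar))\<^sup>2 (norm (xp - xstar))\<^sup>2\<close> of \<open>xstar\<close>, and hence of each other
  (\<open>newton_iterate_quadratic\<close>). The Anderson iterate differs from the Newton iterate by the
  difference of these two, multiplied by the damped coefficient \<open>\<lambda> * \<gamma>\<close>. It therefore
  remains to bound \<open>\<bar>\<lambda> * \<gamma>\<bar>\<close> by the stated quotients, a fact about real numbers that
  follows from the way in which the safeguard chooses \<open>\<lambda>\<close> (\<open>undamped_coefficient_bound\<close>
  and \<open>damped_coefficient_bound\<close>). The role of \<open>na_eta f xp x < 1\<close> is to make
  \<open>\<beta> < 1\<close>, so that these quotients have positive denominators.

  Quadratic convergence rests on two local facts: the derivative is uniformly bounded below near
  \<open>xstar\<close>, and the first-order Taylor remainder is quadratic. Both follow from the linear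
  estimate \<open>norm (f1 x - f1 xstar) \<le> K * norm (x - xstar)\<close> for the derivative \<open>f1\<close>,
  a consequence of its differentiability at \<open>xstar\<close>.
\<close>

section \<open>Local estimates for differentiable maps\<close>

text \<open>
  The increment is the derivative's linear part, controlled by its operator norm, plus an error
  that is eventually at most \<open>norm (x - a)\<close>.
\<close>

lemma has_derivative_imp_local_linear_bound:
  assumes "(g has_derivative g') (at a)"
  obtains K d where "K > 0" "d > 0"
    "\<And>x. norm (x - a) < d \<Longrightarrow> norm (g x - g a) \<le> K * norm (x - a)"
proof -
  from assms have bl: "bounded_linear g'"
    and ev: "\<forall>e>0. \<exists>d>0. \<forall>y. norm (y - a) < d \<longrightarrow> norm (g y - g a - g' (y - a)) \<le> e * norm (y - a)"
    unfolding has_derivative_at_alt by auto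
  from ev obtain d where "d > 0"
    and d: "\<And>y. norm (y - a) < d \<Longrightarrow> norm (g y - g a - g' (y - a)) \<le> norm (y - a)"
    by (metis mult_1 zero_less_one)
  have "norm (g x - g a) \<le> (onorm g' + 1) * norm (x - a)" if "norm (x - a) < d" for x
  proof -
    have "norm (g x - g a) \<le> norm (g x - g a - g' (x - a)) + norm (g' (x - a))"
      using norm_triangle_ineq[of "g x - g a - g' (x - a)" "g' (x - a)"] by simp
    also have "\<dots> \<le> norm (x - a) + onorm g' * norm (x - a)"
      using d[OF that] onorm[OF bl] by (intro add_mono)
    finally show ?thesis by (simp add: algebra_simps)
  qed
  moreover have "onorm g' + 1 > 0"
    using onorm_pos_le[OF bl] by simp
  ultimately show ?thesis using that \<open>d > 0\<close> by blast
qed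

text \<open>
  On the closed ball around \<open>a\<close> through \<open>x\<close>, the derivative varies by at most
  \<open>2 * K * norm (x - a)\<close>, since every value is compared with \<open>f1 a\<close>; the mean value
  inequality then contributes the second factor \<open>norm (x - a)\<close>.
\<close>

lemma quadratic_remainder:
  fixes f :: "'a::real_normed_vector \<Rightarrow> 'b::real_normed_vector"
    and f1 :: "'a \<Rightarrow> 'a \<Rightarrow>\<^sub>L 'b"
  assumes der: "\<And>y. norm (y - a) < d \<Longrightarrow> (f has_derivative blinfun_apply (f1 y)) (at y)"
    and lin: "\<And>y. norm (y - a) < d \<Longrightarrow> norm (f1 y - f1 a) \<le> K * norm (y - a)"
    and K: "K \<ge> 0" and x: "norm (x - a) < d"
  shows "norm (f a - f x - f1 x (a - x)) \<le> 2 * K * (norm (x - a))\<^sup>2"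
proof -
  have "norm (f a - f x - f1 x (a - x)) \<le> norm (a - x) * (2 * K * norm (x - a))"
  proof (rule differentiable_bound_linearization[where S = "cball a (norm (x - a))"
        and f' = "\<lambda>y. blinfun_apply (f1 y)"])
    have "x \<in> cball a (norm (x - a))"
      by (simp add: dist_norm norm_minus_commute)
    moreover have "a \<in> cball a (norm (x - a))"
      by simp
    ultimately show "x + t *\<^sub>R (a - x) \<in> cball a (norm (x - a))" if "t \<in> {0..1}" for t
      using convexD_alt[OF convex_cball, of x a "norm (x - a)" a t] that
      by (simp add: algebra_simps)
    show "x \<in> cball a (norm (x - a))" by fact
  next
    fix y assume y: "y \<in> cball a (norm (x - a))"
    then have y': "norm (y - a) \<le> norm (x - a)"
      by (simp add: dist_norm norm_minus_commute)
    show "(f has_derivative blinfun_apply (f1 y)) (at y within cball a (norm (x - a)))"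
      using y' x by (simp add: has_derivative_at_withinI der)
    have "norm (f1 y - f1 x) \<le> norm (f1 y - f1 a) + norm (f1 x - f1 a)"
      using norm_triangle_ineq4[of "f1 y - f1 a" "f1 x - f1 a"] by simp
    also have "\<dots> \<le> K * norm (y - a) + K * norm (x - a)"
      using y' x by (intro add_mono lin) linarith+
    also have "\<dots> \<le> 2 * K * norm (x - a)"
      using mult_left_mono[OF y' K] by simp
    finally show "onorm (blinfun_apply (f1 y) - blinfun_apply (f1 x)) \<le> 2 * K * norm (x - a)"
      by (simp add: norm_blinfun.rep_eq minus_blinfun.rep_eq fun_diff_def)
  qed
  then show ?thesis
    by (simp add: norm_minus_commute power2_eq_square mult_ac)
qed

section \<open>Quadratic convergence of Newton's method\<close>

lemma matrix_inv_mult_right: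
  fixes A :: "real^'n^'n"
  assumes "invertible A"
  shows "A *v (matrix_inv A *v v) = v"
proof -
  have "A ** matrix_inv A = mat 1"
    using assms unfolding invertible_def matrix_inv_def by (metis (mono_tags, lifting) someI_ex)
  then show ?thesis
    by (simp add: matrix_vector_mul_assoc)
qed

lemma invertible_if_bounded_below:
  fixes A :: "real^'n^'n"
  assumes "c > 0" and "\<And>v. c * norm v \<le> norm (A *v v)"
  shows "invertible A"
proof -
  have "inj ((*v) A)"
  proof (rule linear_injective_0[THEN iffD2, rule_format])
    show "v = 0" if "A *v v = 0" for v
      using assms(2)[of v] \<open>c > 0\<close> that by (simp add: mult_le_0_iff)
  qed simp
  then show ?thesis
    by (simp add: invertible_left_inverse matrix_left_invertible_injective)
qed

text \<open>
  The Jacobian sends the error \<open>newton_iterate f x - xstar\<close> to the first-order Taylor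
  remainder \<open>f xstar - f x - f1 x (xstar - x)\<close>, because \<open>f xstar = 0\<close>. A lower bound on
  the Jacobian near \<open>xstar\<close>, inherited from the one at \<open>xstar\<close> with half the constant, turns
  the quadratic bound on the remainder into one on the error. The same lower bound shows that
  the Jacobian is invertible at \<open>x\<close>, so that \<open>matrix_inv\<close> has its intended value there.
\<close>

lemma newton_iterate_quadratic:
  fixes f :: "real^'n \<Rightarrow> real^'n" and f1 :: "real^'n \<Rightarrow> (real^'n) \<Rightarrow>\<^sub>L (real^'n)"
  assumes der: "\<And>x. (f has_derivative blinfun_apply (f1 x)) (at x)"
    and der2: "(f1 has_derivative f2) (at xstar)"
    and zero: "f xstar = 0" and inv: "invertible (jacobian f (at xstar))"
  obtains \<rho> C where "\<rho> > 0" "C \<ge> 0"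
    "\<And>x. norm (x - xstar) < \<rho> \<Longrightarrow>
       norm (newton_iterate f x - xstar) \<le> C * (norm (x - xstar))\<^sup>2"
proof -
  have jac: "jacobian f (at x) *v v = f1 x v" for x v
  proof -
    have "f differentiable (at x)"
      using der by (rule differentiableI)
    then have "(f has_derivative (*v) (jacobian f (at x))) (at x)"
      by (simp add: jacobian_works)
    from has_derivative_unique[OF this der] show ?thesis by metis
  qed
  obtain K d where "K > 0" "d > 0"
    and lin: "\<And>x. norm (x - xstar) < d \<Longrightarrow> norm (f1 x - f1 xstar) \<le> K * norm (x - xstar)"
    using has_derivative_imp_local_linear_bound[OF der2] by blast
  have "inj ((*v) (jacobian f (at xstar)))"
    using inv by (simp add: invertible_left_inverse matrix_left_invertible_injective)
  then obtain b where "b > 0" and b: "\<And>v. b * norm v \<le> norm (f1 xstar v)"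
    using linear_inj_bounded_below_pos[of "(*v) (jacobian f (at xstar))"] jac
    by (metis matrix_vector_mul_linear)
  \<comment> \<open>Within this radius, the derivative differs from \<open>f1 xstar\<close> by at most \<open>b / 2\<close>.\<close>
  define \<rho> where "\<rho> = min d (b / (2 * K))"
  have "\<rho> > 0"
    using \<open>d > 0\<close> \<open>b > 0\<close> \<open>K > 0\<close> by (simp add: \<rho>_def)
  moreover have "4 * K / b \<ge> 0"
    using \<open>b > 0\<close> \<open>K > 0\<close> by simp
  moreover have "norm (newton_iterate f x - xstar) \<le> 4 * K / b * (norm (x - xstar))\<^sup>2"
    if x: "norm (x - xstar) < \<rho>" for x
  proof -
    have xd: "norm (x - xstar) < d" and xb: "K * norm (x - xstar) \<le> b / 2"
      using x \<open>K > 0\<close> by (auto simp: \<rho>_def field_simps)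
    have below: "b / 2 * norm v \<le> norm (f1 x v)" for v
    proof -
      have "norm ((f1 x - f1 xstar) v) \<le> norm (f1 x - f1 xstar) * norm v"
        by (rule norm_blinfun)
      also have "\<dots> \<le> b / 2 * norm v"
        using lin[OF xd] xb by (intro mult_right_mono) auto
      finally have "norm (f1 x v - f1 xstar v) \<le> b / 2 * norm v"
        by (simp add: blinfun.diff_left)
      then show ?thesis
        using b[of v] norm_triangle_ineq2[of "f1 xstar v" "f1 x v"]
        by (simp add: norm_minus_commute)
    qed
    have "invertible (jacobian f (at x))"
      using \<open>b > 0\<close> below by (intro invertible_if_bounded_below[of "b / 2"]) (auto simp: jac)
    then have "f1 x (newton_update f x) = - f x"
      using matrix_inv_mult_right[of "jacobian f (at x)" "f x"]
      by (simp add: newton_update_def jac blinfun.minus_right)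
    then have "f1 x (newton_iterate f x - xstar) = f xstar - f x - f1 x (xstar - x)"
      by (simp add: newton_iterate_def zero blinfun.add_right blinfun.diff_right)
    then have "b / 2 * norm (newton_iterate f x - xstar) \<le> 2 * K * (norm (x - xstar))\<^sup>2"
      using below[of "newton_iterate f x - xstar"]
        quadratic_remainder[OF der lin _ xd] \<open>K > 0\<close> by simp
    then show ?thesis
      using \<open>b > 0\<close> by (simp add: field_simps)
  qed
  ultimately show ?thesis using that by blast
qed

section \<open>The safeguarded Anderson coefficient\<close>

lemma na_beta_bounds:
  assumes "na_eta f xp x < 1" "0 < rhat"
  shows "0 \<le> na_beta rhat f xp x" "na_beta rhat f xp x < 1"
proof -
  have eta: "0 \<le> na_eta f xp x"
    by (simp add: na_eta_def)
  then have r: "0 \<le> na_r rhat f xp x" "na_r rhat f xp x \<le> na_eta f xp x"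
    using assms by (auto simp: na_r_def)
  show "0 \<le> na_beta rhat f xp x"
    using r(1) eta by (simp add: na_beta_def)
  have "na_beta rhat f xp x \<le> na_r rhat f xp x * 1"
    unfolding na_beta_def using r(1) assms by (intro mult_left_mono) auto
  then show "na_beta rhat f xp x < 1"
    using r(2) assms by simp
qed

text \<open>
  In the damped branch, \<open>\<lambda>\<close> is the factor for which \<open>\<lambda> * \<gamma> = \<beta> / (\<beta> + sgn \<gamma>)\<close>, and
  multiplication by \<open>sgn \<gamma>\<close> brings the absolute value of this into the form of the bound.
\<close>

lemma damping_factor_coefficient:
  fixes \<beta> \<gamma> :: real
  assumes "0 \<le> \<beta>" "\<beta> < 1" "\<gamma> \<noteq> 0"
  shows "\<bar>\<beta> / (\<gamma> * (\<beta> + sgn \<gamma>)) * \<gamma>\<bar> = \<beta> / (1 + sgn \<gamma> * \<beta>)"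
proof -
  have "\<beta> / (\<gamma> * (\<beta> + sgn \<gamma>)) * \<gamma> = \<beta> / (\<beta> + sgn \<gamma>)"
    using assms(3) by simp
  then show ?thesis
    using assms by (auto simp: sgn_if abs_divide add.commute)
qed

text \<open>
  A factor of one arises in two ways. If no damping was needed, then
  \<open>\<bar>\<gamma>\<bar> \<le> \<beta> * \<bar>1 - \<gamma>\<bar> \<le> \<beta> * (1 + \<bar>\<gamma>\<bar>)\<close>, which is solved for \<open>\<bar>\<gamma>\<bar>\<close>. If the damping
  formula happens to return one, the coefficient is \<open>\<beta> / (1 + sgn \<gamma> * \<beta>)\<close>, which is largest
  for negative \<open>\<gamma>\<close>.
\<close>

lemma undamped_coefficient_bound:
  assumes \<beta>: "0 \<le> na_beta rhat f xp x" "na_beta rhat f xp x < 1"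
    and "na_lambda rhat f xp x = 1"
  shows "\<bar>na_lambda rhat f xp x * na_gamma f xp x\<bar>
    \<le> na_beta rhat f xp x / (1 - na_beta rhat f xp x)"
proof -
  define \<gamma> where "\<gamma> = na_gamma f xp x"
  define \<beta> where "\<beta> = na_beta rhat f xp x"
  have b: "0 \<le> \<beta>" "\<beta> < 1"
    using assms by (simp_all add: \<beta>_def)
  have g: "\<gamma> \<noteq> 0" "\<gamma> < 1"
    using assms(3) by (auto simp: na_lambda_def Let_def \<gamma>_def not_le[symmetric])
  have "\<bar>\<gamma>\<bar> \<le> \<beta> / (1 - \<beta>)"
  proof (cases "\<bar>\<gamma>\<bar> / \<bar>1 - \<gamma>\<bar> > \<beta>")
    case True
    then have "\<beta> / (\<gamma> * (\<beta> + sgn \<gamma>)) = 1"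
      using assms(3) g by (auto simp: na_lambda_def Let_def \<gamma>_def \<beta>_def)
    then have "\<bar>\<gamma>\<bar> = \<beta> / (1 + sgn \<gamma> * \<beta>)"
      using damping_factor_coefficient[OF b g(1)] by (metis mult_1)
    also have "\<dots> \<le> \<beta> / (1 - \<beta>)"
      using b g(1) by (intro divide_left_mono mult_pos_pos) (auto simp: sgn_if)
    finally show ?thesis .
  next
    case False
    then have "\<bar>\<gamma>\<bar> \<le> \<beta> * (1 - \<gamma>)"
      using g by (simp add: field_simps)
    also have "\<dots> \<le> \<beta> * (1 + \<bar>\<gamma>\<bar>)"
      using b by (intro mult_left_mono) auto
    finally show ?thesis
      using b by (simp add: field_simps)
  qed
  then show ?thesis
    using assms(3) by (simp add: \<gamma>_def \<beta>_def)
qed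

lemma damped_coefficient_bound:
  assumes \<beta>: "0 \<le> na_beta rhat f xp x" "na_beta rhat f xp x < 1"
    and "na_lambda rhat f xp x < 1"
  shows "\<bar>na_lambda rhat f xp x * na_gamma f xp x\<bar>
    \<le> na_beta rhat f xp x / (1 + sgn (na_gamma f xp x) * na_beta rhat f xp x)"
proof (cases "na_lambda rhat f xp x = 0")
  case True
  then show ?thesis
    using \<beta> by (auto simp: sgn_if)
next
  case False
  then have "na_gamma f xp x \<noteq> 0" and
    "na_lambda rhat f xp x = na_beta rhat f xp x
       / (na_gamma f xp x * (na_beta rhat f xp x + sgn (na_gamma f xp x)))"
    using assms(3) by (auto simp: na_lambda_def Let_def split: if_splits)
  then show ?thesis
    using damping_factor_coefficient[OF \<beta>, of "na_gamma f xp x"] by simp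
qed

section \<open>Distance between the Anderson and Newton iterates\<close>

theorem theorem3p2:
  fixes f :: "real^'n \<Rightarrow> real^'n" and xstar :: "real^'n"
  assumes "C3 f"
    and "f xstar = 0"
    and "invertible (jacobian f (at xstar))"
  shows "\<exists>\<rho>>0. \<exists>C::real. \<forall>rhat\<in>{0<..<1}.
    \<forall>x\<in>ball xstar \<rho>. \<forall>xp\<in>ball xstar \<rho>. na_eta f xp x < 1 \<longrightarrow>
      (na_lambda rhat f xp x = 1 \<longrightarrow>
        norm (na_iterate rhat f xp x - newton_iterate f x)
          \<le> C * (na_beta rhat f xp x / (1 - na_beta rhat f xp x))
              * max ((norm (x - xstar))\<^sup>2) ((norm (xp - xstar))\<^sup>2)) \<and>
      (na_lambda rhat f xp x < 1 \<longrightarrow>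
        norm (na_iterate rhat f xp x - newton_iterate f x)
          \<le> C * (na_beta rhat f xp x / (1 + sgn (na_gamma f xp x) * na_beta rhat f xp x))
              * max ((norm (x - xstar))\<^sup>2) ((norm (xp - xstar))\<^sup>2))"
proof -
  obtain f1 :: "real^'n \<Rightarrow> (real^'n) \<Rightarrow>\<^sub>L (real^'n)" and f2
    where der: "\<And>x. (f has_derivative blinfun_apply (f1 x)) (at x)"
      and der2: "(f1 has_derivative blinfun_apply (f2 xstar)) (at xstar)"
    using assms(1) unfolding C3_def by blast
  obtain \<rho> C where "\<rho> > 0" "C \<ge> 0"
    and newton: "\<And>x. norm (x - xstar) < \<rho> \<Longrightarrow>
      norm (newton_iterate f x - xstar) \<le> C * (norm (x - xstar))\<^sup>2"
    using newton_iterate_quadratic[OF der der2 assms(2,3)] by blast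
  have step: "norm (na_iterate rhat f xp x - newton_iterate f x)
      \<le> 2 * C * q * max ((norm (x - xstar))\<^sup>2) ((norm (xp - xstar))\<^sup>2)"
    if x: "x \<in> ball xstar \<rho>" and xp: "xp \<in> ball xstar \<rho>"
      and q: "\<bar>na_lambda rhat f xp x * na_gamma f xp x\<bar> \<le> q" for rhat x xp q
  proof -
    let ?M = "max ((norm (x - xstar))\<^sup>2) ((norm (xp - xstar))\<^sup>2)"
    have "norm (newton_iterate f x - newton_iterate f xp)
        \<le> norm (newton_iterate f x - xstar) + norm (newton_iterate f xp - xstar)"
      using norm_triangle_ineq4[of "newton_iterate f x - xstar" "newton_iterate f xp - xstar"]
      by simp
    also have "\<dots> \<le> C * (norm (x - xstar))\<^sup>2 + C * (norm (xp - xstar))\<^sup>2"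
      using newton x xp by (intro add_mono) (auto simp: dist_norm norm_minus_commute)
    also have "\<dots> \<le> C * ?M + C * ?M"
      using \<open>C \<ge> 0\<close> by (intro add_mono mult_left_mono) auto
    finally have "norm (newton_iterate f x - newton_iterate f xp) \<le> 2 * C * ?M"
      by simp
    then have "\<bar>na_lambda rhat f xp x * na_gamma f xp x\<bar>
        * norm (newton_iterate f x - newton_iterate f xp) \<le> q * (2 * C * ?M)"
      using q by (intro mult_mono) auto
    then show ?thesis
      by (simp add: na_iterate_def mult_ac)
  qed
  show ?thesis
  proof (rule exI[of _ \<rho>], rule conjI, fact, rule exI[of _ "2 * C"], intro ballI impI conjI)
    fix rhat :: real and x xp
    assume "rhat \<in> {0<..<1}" and ball: "x \<in> ball xstar \<rho>" "xp \<in> ball xstar \<rho>"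
      and "na_eta f xp x < 1"
    then have \<beta>: "0 \<le> na_beta rhat f xp x" "na_beta rhat f xp x < 1"
      using na_beta_bounds[of f xp x rhat] by auto
    {
      assume "na_lambda rhat f xp x = 1"
      from undamped_coefficient_bound[OF \<beta> this] ball
      show "norm (na_iterate rhat f xp x - newton_iterate f x)
          \<le> 2 * C * (na_beta rhat f xp x / (1 - na_beta rhat f xp x))
              * max ((norm (x - xstar))\<^sup>2) ((norm (xp - xstar))\<^sup>2)"
        by (intro step)
    next
      assume "na_lambda rhat f xp x < 1"
      from damped_coefficient_bound[OF \<beta> this] ball
      show "norm (na_iterate rhat f xp x - newton_iterate f x)
          \<le> 2 * C * (na_beta rhat f xp x / (1 + sgn (na_gamma f xp x) * na_beta rhat f xp x))
              * max ((norm (x - xstar))\<^sup>2) ((norm (xp - xstar))\<^sup>2)"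
        by (intro step)
    }
  qed
qed

end
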